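(* The map $\varphi$ is an isomorphism (of measurable dynamical systems, i.e. modulo null sets) between the measure-preserving dynamical systems $(\Omega,\mathbb{P},T)$ and $(X_{\mathscr{B}},\nu_{\mathscr{B}},S)$.
   Context: $\mathbb{N}^*=\{1,2,3,\ldots\}$. $\mathscr{B}=\{b_k:k\ge1\}\subset\{2,3,4,\ldots\}$ is a given infinite set of pairwise relatively prime integers with $\sum_{k\ge1}1/b_k<\infty$. $\Omega=\prod_{k\ge1}\mathbb{Z}/b_k\mathbb{Z}$ is a compact abelian group, $\mathbb{P}$ is its normalized Haar measure, and $T:\Omega\to\Omega$ is $T(\omega_k)_{k\ge1}=(\omega_k+1)_{k\ge1}$. $X=\{0,1\}^{\mathbb{N}^*}$, and $S:X\to X$ is the shift, $(Sx)_n=x_{n+1}$. The map $\varphi:\Omega\to X$ is defined as follows: for $n\in\mathbb{N}^*$, $\varphi(\omega)_n=0$ if there exists $k\ge1$ with $\omega_k+n\equiv0 \bmod b_k$, and $\varphi(\omega)_n=1$ otherwise. One has $S\circ\varphi=\varphi\circ T$. For $A\subset\mathbb{N}^*$ and $b\ge1$, $t(A,b)$ is the number of residue classes modulo $b$ containing an element of $A$. $A$ is $\mathscr{B}$-admissible if $t(A,b_k)<b_k$ for all $k\ge1$. A sequence $x\in X$ is $\mathscr{B}$-admissible if $\{n\in\mathbb{N}^*:x_n=1\}$ is. $X_{\mathscr{B}}$ is the (closed, shift-invariant) set of $\mathscr{B}$-admissible sequences in $X$. $\nu_{\mathscr{B}}$ is the pushforward of $\mathbb{P}$ by $\varphi$,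 i.e. $\nu_{\mathscr{B}}(C)=\mathbb{P}(\varphi^{-1}C)$; it is a shift-invariant probability measure concentrated on $X_{\mathscr{B}}$. *)

theory Defs
  imports "HOL-Probability.Probability" "HOL-Algebra.Product_Groups" "HOL-Number_Theory.Cong"
begin

definition borel_sigma :: "'a topology \<Rightarrow> 'a measure" where
  "borel_sigma X = sigma (topspace X) {U. openin X U}"

text \<open>Left-invariant Borel probability measures on a group \<open>G\<close> that carries a compact topology \<open>X\<close>.
  No regularity condition is imposed: every finite Borel measure on a compact metrizable space,
  such as the group \<open>Omega\<close> below, is regular.\<close>

definition normalized_haar ::
    "('a, 'm) monoid_scheme \<Rightarrow> 'a topology \<Rightarrow> 'a measure \<Rightarrow> bool" where
  "normalized_haar G X M \<longleftrightarrow>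
     sets M = sets (borel_sigma X) \<and> prob_space M \<and>
     (\<forall>g \<in> carrier G. \<forall>A \<in> sets M. emeasure M ((\<lambda>x. g \<otimes>\<^bsub>G\<^esub> x) ` A) = emeasure M A)"

definition measure_preserving_system :: "'a measure \<Rightarrow> ('a \<Rightarrow> 'a) \<Rightarrow> bool" where
  "measure_preserving_system M T \<longleftrightarrow>
     prob_space M \<and> T \<in> measurable M M \<and> distr M M T = M"

text \<open>Isomorphism modulo null sets.  The transformations need not be invertible, so the sets of
  full measure are only required to be forward invariant.\<close>

definition mds_isomorphism ::
    "'a measure \<Rightarrow> ('a \<Rightarrow> 'a) \<Rightarrow> 'b measure \<Rightarrow> ('b \<Rightarrow> 'b) \<Rightarrow> ('a \<Rightarrow> 'b) \<Rightarrow> bool" where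
  "mds_isomorphism M T N S f \<longleftrightarrow>
     measure_preserving_system M T \<and> measure_preserving_system N S \<and>
     (\<exists>M\<^sub>0 \<in> sets M. \<exists>N\<^sub>0 \<in> sets N.
        emeasure M (space M - M\<^sub>0) = 0 \<and> emeasure N (space N - N\<^sub>0) = 0 \<and>
        T ` M\<^sub>0 \<subseteq> M\<^sub>0 \<and> S ` N\<^sub>0 \<subseteq> N\<^sub>0 \<and>
        bij_betw f M\<^sub>0 N\<^sub>0 \<and>
        f \<in> measurable (restrict_space M M\<^sub>0) (restrict_space N N\<^sub>0) \<and>
        the_inv_into M\<^sub>0 f \<in> measurable (restrict_space N N\<^sub>0) (restrict_space M M\<^sub>0) \<and>
        distr (restrict_space M M\<^sub>0) (restrict_space N N\<^sub>0) f = restrict_space N N\<^sub>0 \<and>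
        (\<forall>x \<in> M\<^sub>0. f (T x) = S (f x)))"

text \<open>The set of moduli is \<open>{b k | k. k \<ge> 1}\<close>; the value \<open>b 0\<close> is never used.
  All sequences indexed by the positive integers are functions that are
  \<open>undefined\<close> at \<open>0\<close>, as in \<^const>\<open>PiE\<close>.\<close>

definition Omega :: "(nat \<Rightarrow> nat) \<Rightarrow> (nat \<Rightarrow> int) monoid" where
  "Omega b = product_group {1..} (\<lambda>k. integer_mod_group (b k))"

definition Omega_topology :: "(nat \<Rightarrow> nat) \<Rightarrow> (nat \<Rightarrow> int) topology" where
  "Omega_topology b =
     product_topology (\<lambda>k. discrete_topology (carrier (integer_mod_group (b k)))) {1..}"

definition translation :: "(nat \<Rightarrow> nat) \<Rightarrow> (nat \<Rightarrow> int) \<Rightarrow> (nat \<Rightarrow> int)" where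
  "translation b \<omega> = (\<lambda>k\<in>{1..}. (\<omega> k + 1) mod int (b k))"

definition X_topology :: "(nat \<Rightarrow> nat) topology" where
  "X_topology = product_topology (\<lambda>_. discrete_topology {0, 1}) {1..}"

definition seq_shift :: "(nat \<Rightarrow> nat) \<Rightarrow> (nat \<Rightarrow> nat)" where
  "seq_shift x = (\<lambda>n\<in>{1..}. x (n + 1))"

definition phi :: "(nat \<Rightarrow> nat) \<Rightarrow> (nat \<Rightarrow> int) \<Rightarrow> (nat \<Rightarrow> nat)" where
  "phi b \<omega> = (\<lambda>n\<in>{1..}. if \<exists>k\<ge>1. [\<omega> k + int n = 0] (mod int (b k)) then 0 else 1)"

definition residue_count :: "nat set \<Rightarrow> nat \<Rightarrow> nat" where
  "residue_count A m = card {r. r < m \<and> (\<exists>a\<in>A. [a = r] (mod m))}"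

definition admissible_set :: "(nat \<Rightarrow> nat) \<Rightarrow> nat set \<Rightarrow> bool" where
  "admissible_set b A \<longleftrightarrow> (\<forall>k\<ge>1. residue_count A (b k) < b k)"

definition X_adm :: "(nat \<Rightarrow> nat) \<Rightarrow> (nat \<Rightarrow> nat) set" where
  "X_adm b = {x \<in> topspace X_topology. admissible_set b {n. n \<ge> 1 \<and> x n = 1}}"

text \<open>\<open>nu b P\<close> is a measure on all of \<open>{0,1}\<close>-sequences; the system on the
  admissible sequences is obtained by restricting it to \<open>X_adm b\<close>.\<close>

definition nu :: "(nat \<Rightarrow> nat) \<Rightarrow> (nat \<Rightarrow> int) measure \<Rightarrow> (nat \<Rightarrow> nat) measure" where
  "nu b P = distr P (borel_sigma X_topology) (phi b)"

text \<open>The Haar measure on \<open>Omega\<close> exists: it is the product of the uniform distributions.\<close>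

lemma sets_borel_sigma_product_discrete:
  assumes I: "countable I" and C: "\<And>i. i \<in> I \<Longrightarrow> countable (C i)"
  shows "sets (borel_sigma (product_topology (\<lambda>i. discrete_topology (C i)) I)) =
         sets (PiM I (\<lambda>i. count_space (C i)))" (is "?B = ?P")
proof
  let ?X = "product_topology (\<lambda>i. discrete_topology (C i)) I"
  have B: "?B = sigma_sets (PiE I C) {U. openin ?X U}"
    unfolding borel_sigma_def
  proof -
    have "{U. openin ?X U} \<subseteq> Pow (topspace ?X)"
      using openin_subset[of ?X] by blast
    then have "sets (sigma (topspace ?X) {U. openin ?X U}) = sigma_sets (topspace ?X) {U. openin ?X U}"
      by (rule sets_measure_of)
    then show "sets (sigma (topspace ?X) {U. openin ?X U}) = sigma_sets (PiE I C) {U. openin ?X U}"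
      by simp
  qed
  show "?B \<subseteq> ?P"
    unfolding B
  proof (rule sets.sigma_sets_subset', safe)
    fix U assume U: "openin ?X U"
    define K where "K = (\<lambda>(J, y). prod_emb I (\<lambda>i. count_space (C i)) J (PiE J (\<lambda>j. {y j :: 'b})))"
    define Q where "Q = (SIGMA J:{J. finite J \<and> J \<subseteq> I}. PiE J C)"
    have Qc: "countable Q"
      unfolding Q_def using C
      by (intro countable_SIGMA countable_Collect_finite_subset I countable_PiE) auto
    have K_sets: "K q \<in> ?P" if "q \<in> Q" for q
      using that unfolding Q_def K_def by (auto intro!: sets_PiM_I)
    have "\<exists>q\<in>Q. f \<in> K q \<and> K q \<subseteq> U" if f: "f \<in> U" for f
    proof -
      obtain V where V: "finite {i \<in> I. V i \<noteq> C i}" "f \<in> PiE I V" "PiE I V \<subseteq> U"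
        using bspec[OF U[unfolded openin_product_topology_alt] f]
        unfolding topspace_discrete_topology by blast
      let ?J = "{i \<in> I. V i \<noteq> C i}"
      have fC: "f \<in> PiE I C" using openin_subset[OF U] f by auto
      have "K (?J, restrict f ?J) \<subseteq> PiE I V"
      proof
        fix g assume "g \<in> K (?J, restrict f ?J)"
        then have g: "g \<in> PiE I C" "\<And>j. j \<in> ?J \<Longrightarrow> g j = f j"
          unfolding K_def prod_emb_def by (auto simp: PiE_iff)
        show "g \<in> PiE I V"
        proof (rule PiE_I)
          fix i assume "i \<in> I"
          then show "g i \<in> V i"
            using g V(2) by (cases "V i = C i") auto
        next
          fix i assume "i \<notin> I"
          then show "g i = undefined" using g(1) by auto
        qed
      qed
      moreover have "f \<in> K (?J, restrict f ?J)"
        using fC unfolding K_def prod_emb_def by (auto simp: PiE_iff)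
      moreover have "(?J, restrict f ?J) \<in> Q"
        unfolding Q_def using V(1) fC by auto
      ultimately show ?thesis using V(3) by blast
    qed
    then have "U = (\<Union>q\<in>{q\<in>Q. K q \<subseteq> U}. K q)" by blast
    also have "\<dots> \<in> ?P"
      by (rule sets.countable_UN'') (use Qc K_sets in auto)
    finally show "U \<in> ?P" .
  next
    show "PiE I C \<in> ?P"
      using sets.top[of "PiM I (\<lambda>i. count_space (C i))"] by (simp add: space_PiM)
  qed
  show "?P \<subseteq> ?B"
    unfolding B sets_PiM_single space_count_space
  proof (rule sigma_sets_mono, safe)
    fix i A assume iA: "i \<in> I" "A \<in> sets (count_space (C i))"
    have "openin ?X {f \<in> topspace ?X. f i \<in> A}"
      by (rule openin_continuous_map_preimage[OF continuous_map_product_projection[OF iA(1)]])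
         (use iA in auto)
    then show "{f \<in> PiE I C. f i \<in> A} \<in> sigma_sets (PiE I C) {U. openin ?X U}"
      by (intro sigma_sets.Basic) simp
  qed
qed

lemma normalized_haar_exists:
  assumes b: "\<And>k. k \<ge> 1 \<Longrightarrow> b k \<ge> 2"
  shows "normalized_haar (Omega b) (Omega_topology b)
           (PiM {1..} (\<lambda>k. uniform_count_measure {0..<int (b k)}))"
proof -
  define C where "C = (\<lambda>k. carrier (integer_mod_group (b k)))"
  define \<mu> where "\<mu> = (\<lambda>k. if k \<ge> (1::nat) then uniform_count_measure {0..<int (b k)}
                                else uniform_count_measure {0})"
  have C: "C k = {0..<int (b k)}" if "k \<ge> 1" for k
    using b[OF that] by (auto simp: C_def carrier_integer_mod_group)
  have mu_prob: "prob_space (\<mu> k)" for k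
    using b[of k] unfolding \<mu>_def by (auto intro!: prob_space_uniform_count_measure)
  interpret product_prob_space \<mu> "{1..}"
    by (intro product_prob_spaceI mu_prob)
  have mu_sets: "sets (\<mu> k) = sets (count_space (C k))" if "k \<ge> 1" for k
    using that C[OF that] by (simp add: \<mu>_def sets_uniform_count_measure)
  have eq: "PiM {1..} (\<lambda>k. uniform_count_measure {0..<int (b k)}) = PiM {1..} \<mu>"
    by (rule PiM_cong) (auto simp: \<mu>_def)
  have sets_P: "sets (PiM {1..} \<mu>) = sets (PiM {1..} (\<lambda>k. count_space (C k)))"
    by (rule sets_PiM_cong) (auto simp: mu_sets)
  have sets_B: "sets (PiM {1..} \<mu>) = sets (borel_sigma (Omega_topology b))"
    unfolding sets_P Omega_topology_def C_def
    by (rule sets_borel_sigma_product_discrete[symmetric]) (rule countableI_type)+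
  have space_mu: "space (\<mu> k) = C k" if "k \<ge> 1" for k
    using mu_sets[OF that] by (metis sets_eq_imp_space_eq space_count_space)
  have space_P: "space (PiM {1..} \<mu>) = PiE {1..} C"
    unfolding space_PiM by (rule PiE_cong) (simp add: space_mu)
  have m1: "((x - g) mod m + g) mod m = x"  and m2: "((x + g) mod m - g) mod m = x"
    and m3: "(g + (x - g) mod m) mod m = x" and m4: "((g + x) mod m - g) mod m = x"
    if "x \<in> {0..<m}" for x g m :: int
    using that by (simp_all add: mod_add_left_eq mod_add_right_eq mod_diff_left_eq)
  have inv: "emeasure (PiM {1..} \<mu>) ((\<lambda>x. g \<otimes>\<^bsub>Omega b\<^esub> x) ` A) = emeasure (PiM {1..} \<mu>) A"
    if g: "g \<in> carrier (Omega b)" and A: "A \<in> sets (PiM {1..} \<mu>)" for g A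
  proof -
    define \<tau> where "\<tau> = (\<lambda>x. \<lambda>k\<in>{1..}. (x k - g k) mod int (b k))"
    have mult: "g \<otimes>\<^bsub>Omega b\<^esub> x = (\<lambda>k\<in>{1..}. (g k + x k) mod int (b k))" for x
      by (simp add: Omega_def)
    have \<tau>_meas: "\<tau> \<in> measurable (PiM {1..} \<mu>) (PiM {1..} \<mu>)"
      unfolding \<tau>_def
    proof (rule measurable_restrict)
      fix k :: nat assume k: "k \<in> {1..}"
      have "(\<lambda>x. (x - g k) mod int (b k)) \<in> measurable (\<mu> k) (\<mu> k)"
        using k b[of k] C[of k] mu_sets[of k] space_mu[of k]
        by (simp add: measurable_cong_sets[OF mu_sets mu_sets])
      from measurable_compose[OF measurable_component_singleton[OF k, of \<mu>] this]
      show "(\<lambda>x. (x k - g k) mod int (b k)) \<in> measurable (PiM {1..} \<mu>) (\<mu> k)" .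
    qed
    have distr_eq: "PiM {1..} \<mu> = distr (PiM {1..} \<mu>) (PiM {1..} \<mu>) \<tau>"
    proof (rule measure_eqI_PiM_infinite[where M = \<mu> and I = "{1..}"])
      fix A J assume J: "finite J" "J \<subseteq> {1::nat..}" and A: "\<And>i. i \<in> J \<Longrightarrow> A i \<in> sets (\<mu> i)"
      define A' where "A' = (\<lambda>i. {x \<in> C i. (x - g i) mod int (b i) \<in> A i})"
      have A'_sets: "A' i \<in> sets (\<mu> i)" if "i \<in> J" for i
        using that J mu_sets[of i] by (auto simp: A'_def)
      have A_sub: "A i \<subseteq> C i" if "i \<in> J" for i
        using sets.sets_into_space[OF A[OF that]] space_mu[of i] that J by auto
      have cardA': "emeasure (\<mu> i) (A' i) = emeasure (\<mu> i) (A i)" if i: "i \<in> J" for i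
      proof -
        have i1: "i \<ge> 1" using i J by auto
        have Ci: "C i = {0..<int (b i)}" and bi: "int (b i) > 0"
          using C[OF i1] b[OF i1] by auto
        have "bij_betw (\<lambda>x. (x - g i) mod int (b i)) (A' i) (A i)"
        proof (rule bij_betwI[where g = "\<lambda>x. (x + g i) mod int (b i)"])
          show "(\<lambda>x. (x - g i) mod int (b i)) \<in> A' i \<rightarrow> A i" by (auto simp: A'_def)
          show "(\<lambda>x. (x + g i) mod int (b i)) \<in> A i \<rightarrow> A' i"
          proof
            fix y assume y: "y \<in> A i"
            then have "y \<in> {0..<int (b i)}" using A_sub[OF i] Ci by blast
            from m2[OF this, of "g i"] y show "(y + g i) mod int (b i) \<in> A' i"
              using bi by (simp add: A'_def Ci)
          qed
          show "((x - g i) mod int (b i) + g i) mod int (b i) = x" if "x \<in> A' i" for x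
            using that by (intro m1) (simp add: A'_def Ci)
          show "((y + g i) mod int (b i) - g i) mod int (b i) = y" if "y \<in> A i" for y
            using A_sub[OF i] that Ci by (intro m2) blast
        qed
        then have "card (A' i) = card (A i)" by (rule bij_betw_same_card)
        moreover have "A' i \<subseteq> {0..<int (b i)}" "A i \<subseteq> {0..<int (b i)}"
          using A_sub[OF i] Ci by (auto simp: A'_def)
        ultimately show ?thesis
          using i1 by (simp add: \<mu>_def emeasure_uniform_count_measure)
      qed
      have "\<tau> -` prod_emb {1..} \<mu> J (PiE J A) \<inter> space (PiM {1..} \<mu>) = prod_emb {1..} \<mu> J (PiE J A')"
      proof (intro Set.set_eqI iffI)
        fix x assume "x \<in> \<tau> -` prod_emb {1..} \<mu> J (PiE J A) \<inter> space (PiM {1..} \<mu>)"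
        then have x: "x \<in> space (PiM {1..} \<mu>)" "\<forall>j\<in>J. \<tau> x j \<in> A j"
          by (auto simp: prod_emb_def)
        moreover have "x \<in> PiE {1..} C" using x(1) by (simp only: space_P)
        ultimately show "x \<in> prod_emb {1..} \<mu> J (PiE J A')"
          using J by (auto simp: prod_emb_def A'_def \<tau>_def space_PiM subset_iff PiE_iff)
      next
        fix x assume x: "x \<in> prod_emb {1..} \<mu> J (PiE J A')"
        then have xs: "x \<in> space (PiM {1..} \<mu>)" by (auto simp: prod_emb_def space_PiM)
        have "\<tau> x \<in> space (PiM {1..} \<mu>)" using \<tau>_meas xs by (rule measurable_space)
        then show "x \<in> \<tau> -` prod_emb {1..} \<mu> J (PiE J A) \<inter> space (PiM {1..} \<mu>)"
          using x xs J by (auto simp: prod_emb_def A'_def \<tau>_def space_PiM subset_iff PiE_iff)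
      qed
      then have "emeasure (distr (PiM {1..} \<mu>) (PiM {1..} \<mu>) \<tau>) (prod_emb {1..} \<mu> J (PiE J A)) =
            emeasure (PiM {1..} \<mu>) (prod_emb {1..} \<mu> J (PiE J A'))"
        using J A \<tau>_meas by (subst emeasure_distr) (auto intro!: sets_PiM_I)
      also have "\<dots> = (\<Prod>i\<in>J. emeasure (\<mu> i) (A' i))"
        by (rule emeasure_PiM_emb) (use J A'_sets in auto)
      also have "\<dots> = (\<Prod>i\<in>J. emeasure (\<mu> i) (A i))"
        by (rule prod.cong) (simp_all add: cardA')
      also have "\<dots> = emeasure (PiM {1..} \<mu>) (prod_emb {1..} \<mu> J (PiE J A))"
        by (rule emeasure_PiM_emb[symmetric]) (use J A in auto)
      finally show "emeasure (PiM {1..} \<mu>) (prod_emb {1..} \<mu> J (PiE J A)) =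
          emeasure (distr (PiM {1..} \<mu>) (PiM {1..} \<mu>) \<tau>) (prod_emb {1..} \<mu> J (PiE J A))" by simp
    qed (rule P.finite_measure_axioms refl sets_distr)+
    have A_sub: "A \<subseteq> PiE {1..} C" using sets.sets_into_space[OF A] space_P by simp
    have inv1: "\<tau> (g \<otimes>\<^bsub>Omega b\<^esub> x) = x" if "x \<in> PiE {1..} C" for x
      
    proof
      fix k
      show "\<tau> (g \<otimes>\<^bsub>Omega b\<^esub> x) k = x k"
      proof (cases "k \<in> {1..}")
        case True
        then have "x k \<in> {0..<int (b k)}" using that C[of k] by (auto simp: PiE_iff)
        from m4[OF this, of "g k"] True show ?thesis by (simp add: mult \<tau>_def)
      next
        case False
        with PiE_arb[OF that] show ?thesis by (simp add: mult \<tau>_def)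
      qed
    qed
    have inv2: "g \<otimes>\<^bsub>Omega b\<^esub> \<tau> x = x" if "x \<in> PiE {1..} C" for x
      
    proof
      fix k
      show "(g \<otimes>\<^bsub>Omega b\<^esub> \<tau> x) k = x k"
      proof (cases "k \<in> {1..}")
        case True
        then have "x k \<in> {0..<int (b k)}" using that C[of k] by (auto simp: PiE_iff)
        from m3[OF this, of "g k"] True show ?thesis by (simp add: mult \<tau>_def)
      next
        case False
        with PiE_arb[OF that] show ?thesis by (simp add: mult \<tau>_def)
      qed
    qed
    have closed: "g \<otimes>\<^bsub>Omega b\<^esub> x \<in> PiE {1..} C" if "x \<in> PiE {1..} C" for x
      using that g monoid.m_closed[OF group.is_monoid, of "Omega b" g x]
      by (simp add: Omega_def C_def del: mult_product_group)
    have "(\<lambda>x. g \<otimes>\<^bsub>Omega b\<^esub> x) ` A = \<tau> -` A \<inter> space (PiM {1..} \<mu>)"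
    proof (intro Set.set_eqI iffI)
      fix y assume "y \<in> (\<lambda>x. g \<otimes>\<^bsub>Omega b\<^esub> x) ` A"
      then obtain x where x: "x \<in> A" "y = g \<otimes>\<^bsub>Omega b\<^esub> x" by blast
      then have "x \<in> PiE {1..} C" using A_sub by blast
      from inv1[OF this] closed[OF this] x show "y \<in> \<tau> -` A \<inter> space (PiM {1..} \<mu>)"
        unfolding space_P by (metis IntI vimageI)
    next
      fix y assume "y \<in> \<tau> -` A \<inter> space (PiM {1..} \<mu>)"
      then show "y \<in> (\<lambda>x. g \<otimes>\<^bsub>Omega b\<^esub> x) ` A"
        using inv2[of y] unfolding space_P by (metis IntE imageI vimageE)
    qed
    then have "emeasure (PiM {1..} \<mu>) ((\<lambda>x. g \<otimes>\<^bsub>Omega b\<^esub> x) ` A) =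
        emeasure (distr (PiM {1..} \<mu>) (PiM {1..} \<mu>) \<tau>) A"
      using \<tau>_meas A by (simp add: emeasure_distr)
    also have "\<dots> = emeasure (PiM {1..} \<mu>) A" using distr_eq by simp
    finally show ?thesis .
  qed
  show ?thesis
    unfolding normalized_haar_def eq
    using sets_B inv P.prob_space_axioms by blast
qed

end

theory Submission
  imports Defs
begin

text \<open>The support of \<open>\<phi>(\<omega>)\<close> misses the residue class of \<open>-\<omega>\<^sub>k\<close> modulo \<open>b\<^sub>k\<close>.  If it meets every
  other class, for every \<open>k\<close>, then \<open>\<omega>\<close> can be read off from \<open>\<phi>(\<omega>)\<close>, so it suffices that this
  happens almost surely.  Fix a class \<open>m\<close> modulo \<open>b\<^sub>k\<close> other than that of \<open>-\<omega>\<^sub>k\<close>.  For each \<open>N\<close>, the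
  Chinese remainder theorem provides an element \<open>n\<close> of the class that is not removed by any of
  \<open>b\<^sub>1, \<dots>, b\<^sub>N\<close>; the least one depends only on \<open>\<omega>\<^sub>1, \<dots>, \<omega>\<^sub>N\<close>, so each \<open>j > N\<close> removes it with
  probability at most \<open>1/b\<^sub>j\<close>.  Hence the support misses the class with probability at most
  \<open>\<Sum>\<^sub>j\<^sub>>\<^sub>N 1/b\<^sub>j\<close>, which tends to \<open>0\<close> as \<open>N\<close> grows.\<close>

section \<open>Borel sets of countable discrete products, and residue counts\<close>

lemma space_borel_sigma [simp]: "space (borel_sigma X) = topspace X"
  unfolding borel_sigma_def using openin_subset[of X] by (subst space_measure_of) auto

lemma dvd_mod_add_iff: "m dvd a mod m + c \<longleftrightarrow> m dvd a + c" for m :: int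
  by (simp add: dvd_eq_mod_eq_0 mod_add_left_eq)

text \<open>Since the counted residues lie in \<open>{..<m}\<close>, a count below \<open>m\<close>
  means that some residue is missed. This trades a cardinality for quantifiers over countable
  sets.\<close>

lemma residue_count_less_iff:
  "residue_count A m < m \<longleftrightarrow> (\<exists>r<m. \<forall>a\<in>A. \<not> [a = r] (mod m))"
proof
  let ?R = "{r. r < m \<and> (\<exists>a\<in>A. [a = r] (mod m))}"
  assume "residue_count A m < m"
  then have "?R \<noteq> {..<m}"
    unfolding residue_count_def by (metis card_lessThan less_irrefl)
  then show "\<exists>r<m. \<forall>a\<in>A. \<not> [a = r] (mod m)" by blast
next
  let ?R = "{r. r < m \<and> (\<exists>a\<in>A. [a = r] (mod m))}"
  assume "\<exists>r<m. \<forall>a\<in>A. \<not> [a = r] (mod m)"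
  then have "?R \<subset> {..<m}" by blast
  then have "card ?R < card {..<m}" by (rule psubset_card_mono[rotated]) simp
  then show "residue_count A m < m" by (simp add: residue_count_def)
qed

text \<open>The Borel sets are those of the product of the counting spaces. Off \<open>I\<close>
  every point takes the value \<open>undefined\<close>, so the projection is constant there and the
  rule covers every index.\<close>

lemma measurable_component_product_discrete:
  assumes sets: "sets M = sets (borel_sigma (product_topology (\<lambda>i. discrete_topology (C i)) I))"
    and I: "countable I" and C: "\<And>i. i \<in> I \<Longrightarrow> countable (C i)"
  shows "(\<lambda>x. x i) \<in> measurable M (count_space UNIV)"
proof (cases "i \<in> I")
  case True
  have "(\<lambda>x. x i) \<in> measurable (PiM I (\<lambda>i. count_space (C i))) (count_space (C i))"
    using True by (rule measurable_component_singleton)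
  then have "(\<lambda>x. x i) \<in> measurable M (count_space (C i))"
    using measurable_cong_sets[OF trans[OF sets sets_borel_sigma_product_discrete[OF I C]] refl]
    by blast
  from measurable_compose[OF this, of "\<lambda>x. x" "count_space UNIV"] show ?thesis by simp
next
  case False
  have sp: "space M = PiE I C"
    using sets_eq_imp_space_eq[OF sets] by simp
  have "x i = undefined" if "x \<in> space M" for x
    using that False by (auto simp: sp PiE_iff extensional_def)
  then show ?thesis by (subst measurable_cong[where g = "\<lambda>_. undefined"]) auto
qed

text \<open>Testing coordinates against \<open>count_space UNIV\<close> spares each application from
  tracking the sets \<open>C i\<close>; \<open>fC\<close> restores the smaller codomain.\<close>

lemma measurable_into_product_discrete:
  assumes sets: "sets N = sets (borel_sigma (product_topology (\<lambda>i. discrete_topology (C i)) I))"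
    and I: "countable I" and C: "\<And>i. i \<in> I \<Longrightarrow> countable (C i)"
    and f: "\<And>i. i \<in> I \<Longrightarrow> (\<lambda>x. f x i) \<in> measurable M (count_space UNIV)"
    and fC: "\<And>x. x \<in> space M \<Longrightarrow> f x \<in> PiE I C"
  shows "f \<in> measurable M N"
proof -
  have "(\<lambda>x i. f x i) \<in> measurable M (PiM I (\<lambda>i. count_space (C i)))"
  proof (rule measurable_PiM_single')
    fix i assume i: "i \<in> I"
    show "(\<lambda>x. f x i) \<in> measurable M (count_space (C i))"
    proof (rule measurableI)
      fix x assume "x \<in> space M"
      then show "f x i \<in> space (count_space (C i))" using fC i by auto
    next
      fix A assume "A \<in> sets (count_space (C i))"
      show "(\<lambda>x. f x i) -` A \<inter> space M \<in> sets M"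
        using measurable_sets[OF f[OF i], of A] by simp
    qed
  qed (use fC in auto)
  then show ?thesis
    using measurable_cong_sets[OF refl trans[OF sets sets_borel_sigma_product_discrete[OF I C]]]
    by blast
qed

section \<open>The candidate inverse of \<open>phi\<close>, generic points and partial
  survivors\<close>

text \<open>The reduction modulo \<open>b k\<close> only serves to keep the junk value of \<open>LEAST\<close> inside \<open>Omega\<close>.\<close>

definition phi_inv :: "(nat \<Rightarrow> nat) \<Rightarrow> (nat \<Rightarrow> nat) \<Rightarrow> (nat \<Rightarrow> int)" where
  "phi_inv b x = (\<lambda>k\<in>{1..}. int ((LEAST r. \<forall>n\<in>{1..}. x n = 1 \<longrightarrow> \<not> b k dvd r + n) mod b k))"

text \<open>Requiring \<open>n \<ge> m\<close> rather than \<open>n \<ge> 1\<close> makes the set of generic points forward invariant.\<close>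

definition sieve_generic :: "(nat \<Rightarrow> nat) \<Rightarrow> (nat \<Rightarrow> int) \<Rightarrow> bool" where
  "sieve_generic b \<omega> \<longleftrightarrow> (\<forall>k\<in>{1..}. \<forall>m\<in>{1..}. \<not> int (b k) dvd \<omega> k + int m \<longrightarrow>
     (\<exists>n\<in>{m..}. [n = m] (mod b k) \<and> phi b \<omega> n = 1))"

text \<open>Taking the least candidate makes the choice measurable and dependent on the coordinates
  \<open>1\<close> to \<open>J\<close> alone. If there is no candidate, \<open>LEAST\<close> returns
  one fixed value, so both properties hold at every \<open>\<omega>\<close>.\<close>

definition partial_survivor ::
    "(nat \<Rightarrow> nat) \<Rightarrow> nat \<Rightarrow> nat \<Rightarrow> nat \<Rightarrow> (nat \<Rightarrow> int) \<Rightarrow> nat" where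
  "partial_survivor b k m J \<omega> =
     (LEAST n. m \<le> n \<and> [n = m] (mod b k) \<and> (\<forall>j\<in>{1..J}. \<not> int (b j) dvd \<omega> j + int n))"

lemma phi_eq: "n \<ge> 1 \<Longrightarrow> phi b \<omega> n = (if \<exists>k\<in>{1..}. int (b k) dvd \<omega> k + int n then 0 else 1)"
  by (auto simp: phi_def cong_0_iff)

lemma phi_eq_1_iff: "n \<ge> 1 \<Longrightarrow> phi b \<omega> n = 1 \<longleftrightarrow> (\<forall>k\<in>{1..}. \<not> int (b k) dvd \<omega> k + int n)"
  by (auto simp: phi_eq)

lemma topspace_X: "topspace X_topology = PiE {1..} (\<lambda>_. {0, 1})"
  by (simp add: X_topology_def)

lemma phi_in_X: "phi b \<omega> \<in> topspace X_topology"
  by (auto simp: topspace_X phi_def)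

lemma seq_shift_phi: "seq_shift (phi b \<omega>) = phi b (translation b \<omega>)"
proof
  fix n
  have "int (b k) dvd (\<omega> k + 1) mod int (b k) + int n \<longleftrightarrow> int (b k) dvd \<omega> k + int (n + 1)" for k
    by (simp add: dvd_mod_add_iff add.assoc)
  then show "seq_shift (phi b \<omega>) n = phi b (translation b \<omega>) n"
    by (cases "n \<ge> 1") (auto simp: seq_shift_def phi_eq translation_def, auto simp: phi_def)
qed

text \<open>Admissibility is brought into quantifiers over countable sets, from which the
  measurability of \<open>X_adm b\<close> can be read off.\<close>

lemma X_adm_alt:
  "X_adm b = {x \<in> topspace X_topology.
     \<forall>k\<in>{1..}. \<exists>r\<in>{..<b k}. \<forall>n\<in>{1..}. x n = 1 \<longrightarrow> \<not> [n = r] (mod b k)}"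
  unfolding X_adm_def admissible_set_def residue_count_less_iff
  by (simp add: Bex_def Ball_def imp_conjL)

section \<open>Invariance of admissible and generic sets, and recovery of a point from its
  image\<close>

context
  fixes b :: "nat \<Rightarrow> nat"
  assumes b_ge: "\<And>k. k \<ge> 1 \<Longrightarrow> b k \<ge> 2"
begin

lemma topspace_Omega: "topspace (Omega_topology b) = PiE {1..} (\<lambda>k. {0..<int (b k)})"
  unfolding Omega_topology_def topspace_product_topology
  by (intro PiE_cong) (use b_ge in \<open>force simp: carrier_integer_mod_group\<close>)

lemma phi_in_X_adm: "phi b \<omega> \<in> X_adm b"
proof -
  have "\<exists>r\<in>{..<b k}. \<forall>n\<in>{1..}. phi b \<omega> n = 1 \<longrightarrow> \<not> [n = r] (mod b k)" if k: "k \<in> {1..}" for k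
  proof
    \<comment> \<open>The missed class is that of \<open>- \<omega> k\<close>. As
      \<open>\<omega>\<close> need not lie in \<open>Omega b\<close>, it is reduced to its
      representative in \<open>{..<b k}\<close>.\<close>
    define r where "r = nat ((- \<omega> k) mod int (b k))"
    have b: "b k > 0" using b_ge[of k] k by auto
    then have r: "int r = (- \<omega> k) mod int (b k)" by (simp add: r_def)
    then show "r \<in> {..<b k}" using b by (metis lessThan_iff of_nat_0_less_iff of_nat_less_iff pos_mod_bound)
    show "\<forall>n\<in>{1..}. phi b \<omega> n = 1 \<longrightarrow> \<not> [n = r] (mod b k)"
    proof (intro ballI impI notI)
      fix n assume n: "n \<in> {1..}" "phi b \<omega> n = 1" "[n = r] (mod b k)"
      then have "[int n = int r] (mod int (b k))" by (simp add: cong_int_iff)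
      then have "[int n = - \<omega> k] (mod int (b k))" by (simp add: r cong_def)
      then have "int (b k) dvd \<omega> k + int n" by (simp add: cong_iff_dvd_diff add.commute)
      then show False using phi_eq_1_iff[of n b \<omega>] n k by auto
    qed
  qed
  then show ?thesis using phi_in_X by (simp add: X_adm_alt)
qed

lemma seq_shift_in_X_adm:
  assumes "x \<in> X_adm b" shows "seq_shift x \<in> X_adm b"
proof -
  have x: "x \<in> PiE {1..} (\<lambda>_. {0, 1})" using assms by (simp add: X_adm_alt topspace_X)
  then have "seq_shift x \<in> topspace X_topology"
    by (auto simp: topspace_X seq_shift_def PiE_iff)
  moreover have "\<exists>r\<in>{..<b k}. \<forall>n\<in>{1..}. seq_shift x n = 1 \<longrightarrow> \<not> [n = r] (mod b k)"
    if k: "k \<in> {1..}" for k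
  proof -
    obtain r where r: "r < b k" "\<forall>n\<in>{1..}. x n = 1 \<longrightarrow> \<not> [n = r] (mod b k)"
      using assms k by (auto simp: X_adm_alt)
    \<comment> \<open>The shift moves the missed class down by one; adding \<open>b k - 1\<close>
      instead of subtracting \<open>1\<close> avoids truncation at \<open>r = 0\<close>.\<close>
    define s where "s = (r + (b k - 1)) mod b k"
    have "[s + 1 = r] (mod b k)"
      using r(1) by (simp add: s_def cong_def mod_add_left_eq mod_Suc_eq)
    then have "\<not> [n = s] (mod b k)" if "n \<ge> 1" "seq_shift x n = 1" for n
      using that r(2) cong_add[of n s "b k" 1 1] cong_trans[of "n + 1" "s + 1" "b k" r]
      by (auto simp: seq_shift_def)
    moreover have "s < b k" using r(1) by (simp add: s_def)
    ultimately show ?thesis by auto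
  qed
  ultimately show ?thesis by (simp add: X_adm_alt)
qed

lemma phi_inv_in_Omega: "phi_inv b x \<in> topspace (Omega_topology b)"
  using b_ge by (force simp: topspace_Omega phi_inv_def)

lemma translation_in_Omega: "translation b \<omega> \<in> topspace (Omega_topology b)"
  using b_ge by (force simp: topspace_Omega translation_def)

text \<open>Genericity leaves the class of \<open>- \<omega> k\<close> as the only one missed, so
  \<open>LEAST\<close> accepts \<open>r\<close> exactly when \<open>r\<close> is congruent to
  \<open>\<omega> k\<close>. The least such \<open>r\<close> is the reduced value
  \<open>\<omega> k\<close> itself.\<close>

lemma phi_inv_phi:
  assumes \<omega>: "\<omega> \<in> topspace (Omega_topology b)" and gen: "sieve_generic b \<omega>"
  shows "phi_inv b (phi b \<omega>) = \<omega>"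
proof
  fix k
  show "phi_inv b (phi b \<omega>) k = \<omega> k"
  proof (cases "k \<ge> 1")
    case False
    then show ?thesis using \<omega> by (auto simp: phi_inv_def topspace_Omega PiE_iff extensional_def)
  next
    case k: True
    have wk: "0 \<le> \<omega> k" "\<omega> k < int (b k)" using \<omega> k by (auto simp: topspace_Omega PiE_iff)
    have "(LEAST r. \<forall>n\<in>{1..}. phi b \<omega> n = 1 \<longrightarrow> \<not> b k dvd r + n) = nat (\<omega> k)"
    proof (rule Least_equality)
      show "\<forall>n\<in>{1..}. phi b \<omega> n = 1 \<longrightarrow> \<not> b k dvd nat (\<omega> k) + n"
      proof (intro ballI impI notI)
        fix n assume n: "n \<in> {1..}" "phi b \<omega> n = 1" "b k dvd nat (\<omega> k) + n"
        from n(3) have "int (b k) dvd \<omega> k + int n" 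
          using wk by (metis int_dvd_int_iff int_nat_eq of_nat_add)
        then show False using phi_eq_1_iff[of n b \<omega>] n k by auto
      qed
    next
      fix r assume r: "\<forall>n\<in>{1..}. phi b \<omega> n = 1 \<longrightarrow> \<not> b k dvd r + n"
      show "nat (\<omega> k) \<le> r"
      proof (rule ccontr)
        assume "\<not> nat (\<omega> k) \<le> r"
        then have rk: "int r < \<omega> k" "r < b k" using wk by auto
        \<comment> \<open>A positive representative of the class of \<open>- r\<close>. Since
          \<open>0 < \<omega> k - r < b k\<close>, this is not the class of
          \<open>- \<omega> k\<close>, so genericity puts a survivor in it, against the choice of
          \<open>r\<close>.\<close>
        define m where "m = b k - r"
        have m: "m \<ge> 1" "int m = int (b k) - int r" using rk by (auto simp: m_def)
        have "\<not> int (b k) dvd \<omega> k + int m"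
        proof
          assume "int (b k) dvd \<omega> k + int m"
          then have "int (b k) dvd (\<omega> k - int r) + int (b k)" by (simp add: m algebra_simps)
          then have "int (b k) dvd \<omega> k - int r" by simp
          then show False using rk wk zdvd_not_zless[of "\<omega> k - int r" "int (b k)"] by auto
        qed
        then obtain n where n: "n \<ge> m" "[n = m] (mod b k)" "phi b \<omega> n = 1"
          using gen k m(1) by (auto simp: sieve_generic_def)
        have "[r + n = r + m] (mod b k)" using n(2) by (simp add: cong_add_lcancel_nat)
        then have "b k dvd r + n"
          using rk by (simp add: m_def cong_def dvd_eq_mod_eq_0)
        then show False using r n m by auto
      qed
    qed
    then show ?thesis using k wk by (simp add: phi_inv_def)
  qed
qed

text \<open>By equivariance a survivor \<open>n\<close> of \<open>\<omega>\<close> gives the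
  survivor \<open>n - 1\<close> of its translate, so a witness for \<open>m + 1\<close> yields one
  for \<open>m\<close>. The bound \<open>n \<ge> m + 1\<close> ensures \<open>n - 1 \<ge> m\<close>,
  in particular positivity.\<close>

lemma sieve_generic_translation:
  assumes "sieve_generic b \<omega>" shows "sieve_generic b (translation b \<omega>)"
  unfolding sieve_generic_def
proof (intro ballI impI)
  fix k m :: nat
  assume k: "k \<in> {1..}" and m: "m \<in> {1..}"
    and nd: "\<not> int (b k) dvd translation b \<omega> k + int m"
  have "\<not> int (b k) dvd \<omega> k + int (m + 1)"
    using nd k by (simp add: translation_def dvd_mod_add_iff add.assoc)
  then obtain n where n: "n \<ge> m + 1" "[n = m + 1] (mod b k)" "phi b \<omega> n = 1"
    using assms k unfolding sieve_generic_def by (metis atLeast_iff le_add2)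
  then obtain n' where n': "n = n' + 1" "n' \<ge> m" by (metis add_le_cancel_right le_add2 le_Suc_ex add.commute add.left_commute)
  have "phi b (translation b \<omega>) n' = 1"
    using n n' m by (simp add: seq_shift_phi[symmetric] seq_shift_def)
  moreover have "[n' = m] (mod b k)" using n(2) n'(1) by (metis cong_add_rcancel_nat)
  ultimately show "\<exists>n\<in>{m..}. [n = m] (mod b k) \<and> phi b (translation b \<omega>) n = 1"
    using n' by auto
qed

section \<open>Integers surviving finitely many moduli\<close>

lemma partial_survivor:
  fixes J :: nat
  assumes cop: "\<And>i j. i \<ge> 1 \<Longrightarrow> j \<ge> 1 \<Longrightarrow> i \<noteq> j \<Longrightarrow> coprime (b i) (b j)"
    and k: "k \<ge> 1" and nd: "\<not> int (b k) dvd \<omega> k + int m"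
  defines "n \<equiv> partial_survivor b k m J \<omega>"
  shows "m \<le> n" "[n = m] (mod b k)" "\<And>j. j \<in> {1..J} \<Longrightarrow> \<not> int (b j) dvd \<omega> j + int n"
proof -
  let ?K = "insert k {1..J}"
  \<comment> \<open>Away from \<open>k\<close> the residue \<open>1 - \<omega> j\<close> is
    prescribed so that \<open>\<omega> j + x\<close> is congruent to \<open>1\<close>, which
    \<open>b j \<ge> 2\<close> does not divide.\<close>
  define u where "u = (\<lambda>j. if j = k then m else nat ((1 - \<omega> j) mod int (b j)))"
  have "\<exists>x. \<forall>i\<in>?K. [x = u i] (mod b i)"
    by (rule chinese_remainder_nat) (use cop k in auto)
  then obtain x where x: "\<And>i. i \<in> ?K \<Longrightarrow> [x = u i] (mod b i)" by blast
  \<comment> \<open>Adding a multiple of the positive product lifts the solution to at least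
    \<open>m\<close> and keeps all its residues.\<close>
  define y where "y = x + m * (\<Prod>i\<in>?K. b i)"
  have b_pos: "b i > 0" if "i \<in> ?K" for i using b_ge[of i] that k by auto
  have y: "[y = u i] (mod b i)" if "i \<in> ?K" for i
  proof -
    have "b i dvd (\<Prod>i\<in>?K. b i)" using that by (intro dvd_prodI) auto
    then have "[m * (\<Prod>i\<in>?K. b i) = 0] (mod b i)" by (simp add: cong_0_iff)
    from cong_add[OF x[OF that] this] show ?thesis by (simp add: y_def)
  qed
  have "(\<Prod>i\<in>?K. b i) > 0" using b_pos by (intro prod_pos) auto
  then have "m \<le> m * (\<Prod>i\<in>?K. b i)" by (cases "\<Prod>i\<in>?K. b i") auto
  then have my: "m \<le> y" unfolding y_def by (rule trans_le_add2)
  have yk: "[y = m] (mod b k)" using y[of k] by (simp add: u_def)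
  have "\<not> int (b j) dvd \<omega> j + int y" if j: "j \<in> {1..J}" for j
  \<comment> \<open>If \<open>k \<le> J\<close>, the modulus \<open>b k\<close> is also among those
    to be avoided; there \<open>y\<close> lies in the class of \<open>m\<close>, and
    \<open>nd\<close> applies.\<close>
  proof (cases "j = k")
    case True
    have "[int y = int m] (mod int (b k))" using yk by (simp add: cong_int_iff)
    then have "[\<omega> k + int y = \<omega> k + int m] (mod int (b k))" by (simp add: cong_add_lcancel)
    then show ?thesis using nd True cong_dvd_iff by blast
  next
    case False
    have bj: "b j \<ge> 2" using b_ge j by auto
    have "[int y = int (u j)] (mod int (b j))" using y[of j] j by (simp add: cong_int_iff)
    moreover have "[int (u j) = 1 - \<omega> j] (mod int (b j))"
      using bj False by (simp add: u_def cong_def)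
    ultimately have "[int y = 1 - \<omega> j] (mod int (b j))" by (rule cong_trans)
    then have "[\<omega> j + int y = \<omega> j + (1 - \<omega> j)] (mod int (b j))" by (simp only: cong_add_lcancel)
    then have "[\<omega> j + int y = 1] (mod int (b j))" by simp
    then show ?thesis using bj cong_dvd_iff by fastforce
  qed
  with my yk have "m \<le> y \<and> [y = m] (mod b k) \<and> (\<forall>j\<in>{1..J}. \<not> int (b j) dvd \<omega> j + int y)"
    by blast
  then have "m \<le> n \<and> [n = m] (mod b k) \<and> (\<forall>j\<in>{1..J}. \<not> int (b j) dvd \<omega> j + int n)"
    unfolding n_def partial_survivor_def by (rule LeastI)
  then show "m \<le> n" "[n = m] (mod b k)" "\<And>j. j \<in> {1..J} \<Longrightarrow> \<not> int (b j) dvd \<omega> j + int n"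
    by blast+
qed

section \<open>Haar measure on \<open>Omega b\<close> and measurability of the maps\<close>

context
  fixes P :: "(nat \<Rightarrow> int) measure"
  assumes haar: "normalized_haar (Omega b) (Omega_topology b) P"
begin

interpretation P: prob_space P using haar by (simp add: normalized_haar_def)

lemma sets_P: "sets P = sets (borel_sigma (Omega_topology b))"
  using haar by (simp add: normalized_haar_def)

lemma space_P: "space P = PiE {1..} (\<lambda>k. {0..<int (b k)})"
  using sets_eq_imp_space_eq[OF sets_P] by (simp add: topspace_Omega)

lemma carrier_Omega: "carrier (Omega b) = space P"
  unfolding space_P Omega_def carrier_product_group
  by (intro PiE_cong) (use b_ge in \<open>force simp: carrier_integer_mod_group\<close>)

lemma mult_Omega: "g \<otimes>\<^bsub>Omega b\<^esub> \<omega> = (\<lambda>k\<in>{1..}. (g k + \<omega> k) mod int (b k))"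
  by (simp add: Omega_def)

lemma measurable_P_component [measurable]: "(\<lambda>\<omega>. \<omega> k) \<in> measurable P (count_space UNIV)"
  by (rule measurable_component_product_discrete[OF sets_P[unfolded Omega_topology_def]]) auto

lemma measurable_X_component [measurable]:
  "(\<lambda>x. x n) \<in> measurable (borel_sigma X_topology) (count_space UNIV)"
  by (rule measurable_component_product_discrete[OF arg_cong[OF X_topology_def, of "\<lambda>X. sets (borel_sigma X)"]])
    auto

lemma measurable_into_X:
  assumes "\<And>n. n \<ge> 1 \<Longrightarrow> (\<lambda>x. f x n) \<in> measurable M (count_space UNIV)"
    and "\<And>x. x \<in> space M \<Longrightarrow> f x \<in> topspace X_topology"
  shows "f \<in> measurable M (borel_sigma X_topology)"
  by (rule measurable_into_product_discrete[OF arg_cong[OF X_topology_def, of "\<lambda>X. sets (borel_sigma X)"]])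
    (use assms in \<open>auto simp: topspace_X\<close>)

lemma measurable_into_P:
  assumes "\<And>k. k \<ge> 1 \<Longrightarrow> (\<lambda>x. f x k) \<in> measurable M (count_space UNIV)"
    and "\<And>x. x \<in> space M \<Longrightarrow> f x \<in> topspace (Omega_topology b)"
  shows "f \<in> measurable M P"
  by (rule measurable_into_product_discrete[OF sets_P[unfolded Omega_topology_def]])
    (use assms in \<open>auto simp: Omega_topology_def\<close>)

lemma phi_measurable [measurable]: "phi b \<in> measurable P (borel_sigma X_topology)"
proof (rule measurable_into_X)
  fix n :: nat assume "n \<ge> 1"
  then show "(\<lambda>\<omega>. phi b \<omega> n) \<in> measurable P (count_space UNIV)"
    by (subst phi_eq, assumption) measurable
qed (rule phi_in_X)

lemma phi_inv_measurable [measurable]: "phi_inv b \<in> measurable (borel_sigma X_topology) P"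
proof (rule measurable_into_P)
  fix k :: nat assume "k \<ge> 1"
  then show "(\<lambda>x. phi_inv b x k) \<in> measurable (borel_sigma X_topology) (count_space UNIV)"
  proof -
    have "(\<lambda>x. LEAST r. \<forall>n\<in>{1..}. x n = 1 \<longrightarrow> \<not> b k dvd r + n)
        \<in> measurable (borel_sigma X_topology) (count_space UNIV)"
      by measurable
    from measurable_compose[OF this, of "\<lambda>r. int (r mod b k)" "count_space UNIV"] \<open>k \<ge> 1\<close>
    show ?thesis by (simp add: phi_inv_def)
  qed
qed (rule phi_inv_in_Omega)

lemma seq_shift_measurable [measurable]:
  "seq_shift \<in> measurable (borel_sigma X_topology) (borel_sigma X_topology)"
proof (rule measurable_into_X)
  fix n :: nat assume "n \<ge> 1"
  then show "(\<lambda>x. seq_shift x n) \<in> measurable (borel_sigma X_topology) (count_space UNIV)"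
    unfolding seq_shift_def by simp
qed (auto simp: topspace_X seq_shift_def PiE_iff)

lemma translation_measurable [measurable]: "translation b \<in> measurable P P"
proof (rule measurable_into_P)
  fix k :: nat assume "k \<ge> 1"
  then show "(\<lambda>\<omega>. translation b \<omega> k) \<in> measurable P (count_space UNIV)"
    using measurable_compose[OF measurable_P_component[of k],
        of "\<lambda>a. (a + 1) mod int (b k)" "count_space UNIV"]
    by (simp add: translation_def)
qed (rule translation_in_Omega)

lemma X_adm_measurable [measurable]: "X_adm b \<in> sets (borel_sigma X_topology)"
proof -
  have "{x \<in> space (borel_sigma X_topology).
     \<forall>k\<in>{1..}. \<exists>r\<in>{..<b k}. \<forall>n\<in>{1..}. x n = 1 \<longrightarrow> \<not> [n = r] (mod b k)} \<in> sets (borel_sigma X_topology)"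
    by measurable
  then show ?thesis by (simp add: X_adm_alt)
qed

lemma sieve_generic_measurable [measurable]: "Measurable.pred P (sieve_generic b)"
proof -
  have [measurable]: "(\<lambda>\<omega>. phi b \<omega> n) \<in> measurable P (count_space UNIV)" for n
    using measurable_compose[OF phi_measurable measurable_X_component] .
  show ?thesis unfolding sieve_generic_def[abs_def] by measurable
qed

text \<open>The translation is multiplication by the group element whose coordinates are all
  \<open>1\<close>, so Haar invariance applies.\<close>

lemma distr_translation: "distr P P (translation b) = P"
proof (rule measure_eqI)
  fix A assume "A \<in> sets (distr P P (translation b))"
  then have A: "A \<in> sets P" by simp
  define g where "g = (\<lambda>k\<in>{1::nat..}. 1::int)"
  have g: "g \<in> carrier (Omega b)"
    unfolding carrier_Omega space_P g_def using b_ge by force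
  have tr: "translation b \<omega> = g \<otimes>\<^bsub>Omega b\<^esub> \<omega>" for \<omega>
    by (simp add: mult_Omega translation_def g_def add.commute cong: restrict_cong)
  let ?B = "translation b -` A \<inter> space P"
  \<comment> \<open>Haar invariance is stated for images, the pushforward for preimages.
    Surjectivity of the translation links them: \<open>A\<close> is the image of its own
    preimage.\<close>
  have "(\<lambda>\<omega>. g \<otimes>\<^bsub>Omega b\<^esub> \<omega>) ` ?B = A"
  proof
    show "(\<lambda>\<omega>. g \<otimes>\<^bsub>Omega b\<^esub> \<omega>) ` ?B \<subseteq> A" by (auto simp: tr)
    show "A \<subseteq> (\<lambda>\<omega>. g \<otimes>\<^bsub>Omega b\<^esub> \<omega>) ` ?B"
    proof
      fix y assume y: "y \<in> A"
      then have ys: "y \<in> space P" using sets.sets_into_space[OF A] by blast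
      define x where "x = (\<lambda>k\<in>{1..}. (y k - 1) mod int (b k))"
      have x: "x \<in> space P" unfolding space_P x_def using b_ge by force
      have "translation b x = y"
      proof
        fix k show "translation b x k = y k"
          using ys by (cases "k \<ge> 1")
            (auto simp: translation_def x_def mod_add_left_eq space_P PiE_iff extensional_def)
      qed
      with x y show "y \<in> (\<lambda>\<omega>. g \<otimes>\<^bsub>Omega b\<^esub> \<omega>) ` ?B"
        by (intro image_eqI[of _ _ x]) (auto simp: tr)
    qed
  qed
  moreover have "emeasure P ((\<lambda>\<omega>. g \<otimes>\<^bsub>Omega b\<^esub> \<omega>) ` ?B) = emeasure P ?B"
    using haar g A unfolding normalized_haar_def by (metis measurable_sets translation_measurable)
  ultimately show "emeasure (distr P P (translation b)) A = emeasure P A"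
    using A by (simp add: emeasure_distr)
qed simp

section \<open>Almost every point is generic\<close>

text \<open>Rotating the \<open>j\<close>-th coordinate alone maps the event into the disjoint events
  \<open>\<omega> j + h \<omega> \<equiv> i\<close>, so invariance gives the bound without identifying \<open>P\<close> as a product measure.\<close>

lemma prob_dvd_le:
  assumes j: "j \<ge> 1" and [measurable]: "h \<in> measurable P (count_space UNIV)"
    and indep: "\<And>\<omega> a. h (fun_upd \<omega> j a) = h \<omega>"
  shows "P.prob {\<omega> \<in> space P. int (b j) dvd \<omega> j + int (h \<omega>)} \<le> 1 / real (b j)"
proof -
  have bj: "b j \<ge> 2" using b_ge j .
  define A where "A = (\<lambda>i. {\<omega> \<in> space P. (\<omega> j + int (h \<omega>)) mod int (b j) = int i})"
  have A_sets [measurable]: "A i \<in> sets P" for i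
  proof -
    \<comment> \<open>Measurability is checked with \<open>h \<omega>\<close> frozen at
      \<open>n\<close>, and the countably many values of \<open>h\<close> are then glued
      together.\<close>
    have "(\<lambda>\<omega>. (\<omega> j + int n) mod int (b j) = int i) \<in> measurable P (count_space UNIV)" for n
      using measurable_compose[OF measurable_P_component[of j],
          of "\<lambda>a. (a + int n) mod int (b j) = int i" "count_space UNIV"] by simp
    from measurable_compose_countable[OF this assms(2)] show ?thesis
      unfolding A_def by measurable
  qed
  have le: "P.prob (A 0) \<le> P.prob (A i)" if i: "i < b j" for i
  proof -
    define g where "g = (\<lambda>k\<in>{1..}. if k = j then int i else 0)"
    have g: "g \<in> carrier (Omega b)"
      unfolding carrier_Omega space_P g_def using b_ge i by force
    have "(\<lambda>\<omega>. g \<otimes>\<^bsub>Omega b\<^esub> \<omega>) ` A 0 \<subseteq> A i"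
    proof safe
      fix \<omega> assume \<omega>: "\<omega> \<in> A 0"
      then have sp: "\<omega> \<in> space P" and z: "(\<omega> j + int (h \<omega>)) mod int (b j) = 0"
        by (auto simp: A_def)
      \<comment> \<open>Elsewhere \<open>g\<close> adds \<open>0\<close> to coordinates that are
        already reduced, so only coordinate \<open>j\<close> changes and \<open>indep\<close> keeps
        the value of \<open>h\<close>.\<close>
      have eq: "g \<otimes>\<^bsub>Omega b\<^esub> \<omega> = fun_upd \<omega> j ((int i + \<omega> j) mod int (b j))"
        using sp j by (auto simp: mult_Omega g_def space_P PiE_iff extensional_def fun_eq_iff)
      have "((int i + \<omega> j) mod int (b j) + int (h \<omega>)) mod int (b j)
          = (int i + (\<omega> j + int (h \<omega>)) mod int (b j)) mod int (b j)"
        by (simp add: mod_add_left_eq mod_add_right_eq add.assoc)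
      also have "\<dots> = int i" using z i by simp
      finally have "((int i + \<omega> j) mod int (b j) + int (h \<omega>)) mod int (b j) = int i" .
      moreover have "fun_upd \<omega> j ((int i + \<omega> j) mod int (b j)) \<in> space P"
        using sp j bj by (auto simp: space_P PiE_iff extensional_def)
      ultimately show "g \<otimes>\<^bsub>Omega b\<^esub> \<omega> \<in> A i" by (simp add: eq A_def indep)
    qed
    then have "emeasure P ((\<lambda>\<omega>. g \<otimes>\<^bsub>Omega b\<^esub> \<omega>) ` A 0) \<le> emeasure P (A i)"
      by (intro emeasure_mono) auto
    moreover have "emeasure P ((\<lambda>\<omega>. g \<otimes>\<^bsub>Omega b\<^esub> \<omega>) ` A 0) = emeasure P (A 0)"
      using haar g A_sets unfolding normalized_haar_def by blast
    ultimately show ?thesis by (simp add: P.emeasure_eq_measure)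
  qed
  have disj: "disjoint_family_on A {..<b j}"
    by (auto simp: disjoint_family_on_def A_def)
  have "real (b j) * P.prob (A 0) = (\<Sum>i<b j. P.prob (A 0))" by simp
  also have "\<dots> \<le> (\<Sum>i<b j. P.prob (A i))" by (intro sum_mono le) simp
  also have "\<dots> = P.prob (\<Union>i<b j. A i)"
    using A_sets disj by (intro P.finite_measure_finite_Union[symmetric]) auto
  also have "\<dots> \<le> 1" by simp
  finally have "P.prob (A 0) \<le> 1 / real (b j)" using bj by (simp add: field_simps)
  then show ?thesis by (simp add: A_def dvd_eq_mod_eq_0)
qed

lemma partial_survivor_measurable [measurable]:
  "partial_survivor b k m J \<in> measurable P (count_space UNIV)"
  unfolding partial_survivor_def[abs_def] by measurable

lemma AE_survivor:
  assumes cop: "\<And>i j. i \<ge> 1 \<Longrightarrow> j \<ge> 1 \<Longrightarrow> i \<noteq> j \<Longrightarrow> coprime (b i) (b j)"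
    and summ: "summable (\<lambda>j. 1 / real (b j))"
    and k: "k \<ge> 1" and m: "m \<ge> 1"
  shows "AE \<omega> in P. \<not> int (b k) dvd \<omega> k + int m \<longrightarrow>
     (\<exists>n\<in>{m..}. [n = m] (mod b k) \<and> phi b \<omega> n = 1)"
proof -
  have phim [measurable]: "(\<lambda>\<omega>. phi b \<omega> n) \<in> measurable P (count_space UNIV)" for n
    using measurable_compose[OF phi_measurable measurable_X_component] .
  define Bad where "Bad = {\<omega> \<in> space P. \<not> (\<not> int (b k) dvd \<omega> k + int m \<longrightarrow>
     (\<exists>n\<in>{m..}. [n = m] (mod b k) \<and> phi b \<omega> n = 1))}"
  have Bad_sets [measurable]: "Bad \<in> sets P" unfolding Bad_def by measurable
  have "P.prob Bad \<le> 0 + e" if e: "e > 0" for e :: real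
  proof -
    \<comment> \<open>The reciprocals of the moduli after the first \<open>N\<close> sum to less
      than \<open>e\<close>, and only those moduli can remove a survivor of the first
      \<open>N\<close>.\<close>
    obtain N where N: "\<And>n. n \<ge> N \<Longrightarrow> norm (\<Sum>i. 1 / real (b (i + n))) < e"
      using suminf_exist_split[OF e summ] by blast
    define H where "H = (\<lambda>i. {\<omega> \<in> space P.
      int (b (i + Suc N)) dvd \<omega> (i + Suc N) + int (partial_survivor b k m N \<omega>)})"
    have H_sets: "H i \<in> sets P" for i unfolding H_def by measurable
    have H_le: "P.prob (H i) \<le> 1 / real (b (i + Suc N))" for i
      unfolding H_def
    \<comment> \<open>The index \<open>i + Suc N\<close> exceeds \<open>N\<close>, so
      \<open>partial_survivor b k m N\<close> does not read that coordinate, even when the index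
      equals \<open>k\<close>.\<close>
    proof (rule prob_dvd_le)
      show "partial_survivor b k m N (fun_upd \<omega> (i + Suc N) a) = partial_survivor b k m N \<omega>" for \<omega> a
        unfolding partial_survivor_def by (rule arg_cong[where f = Least]) (auto simp: fun_eq_iff)
    qed auto
    have tail: "summable (\<lambda>i. 1 / real (b (i + Suc N)))"
      using summ by (rule summable_ignore_initial_segment)
    have H_summ: "summable (\<lambda>i. P.prob (H i))"
      by (rule summable_comparison_test'[OF tail, of 0]) (use H_le in auto)
    have "Bad \<subseteq> (\<Union>i. H i)"
    proof
      fix \<omega> assume \<omega>: "\<omega> \<in> Bad"
      then have sp: "\<omega> \<in> space P" and nd: "\<not> int (b k) dvd \<omega> k + int m"
        and none: "\<And>n. n \<ge> m \<Longrightarrow> [n = m] (mod b k) \<Longrightarrow> phi b \<omega> n \<noteq> 1"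
        by (auto simp: Bad_def)
      define n where "n = partial_survivor b k m N \<omega>"
      note surv = partial_survivor[where \<omega> = \<omega> and J = N and k = k and m = m, OF cop k nd, folded n_def]
      have "phi b \<omega> n \<noteq> 1" using none surv by blast
      then obtain j where j: "j \<ge> 1" "int (b j) dvd \<omega> j + int n"
        using phi_eq_1_iff[of n b \<omega>] surv(1) m by auto
      then have "j > N" using surv(3)[of j] by fastforce
      then obtain i where "j = i + Suc N" by (metis add.commute less_imp_Suc_add add_Suc_right)
      then have "\<omega> \<in> H i" using j sp by (simp add: H_def n_def)
      then show "\<omega> \<in> (\<Union>i. H i)" by blast
    qed
    then have "P.prob Bad \<le> P.prob (\<Union>i. H i)"
      using H_sets by (intro P.finite_measure_mono) auto
    also have "\<dots> \<le> (\<Sum>i. P.prob (H i))"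
      using H_sets H_summ by (intro P.finite_measure_subadditive_countably) auto
    also have "\<dots> \<le> (\<Sum>i. 1 / real (b (i + Suc N)))"
      by (rule suminf_le[OF H_le H_summ tail])
    also have "\<dots> \<le> e" using N[of "Suc N"] by simp
    finally show ?thesis by simp
  qed
  then have "P.prob Bad \<le> 0" by (rule field_le_epsilon)
  then have "P.prob Bad = 0" by (simp add: measure_le_0_iff)
  then have "emeasure P Bad = 0" by (simp add: P.emeasure_eq_measure)
  then show ?thesis
    by (intro AE_I[of _ _ Bad]) (auto simp: Bad_def)
qed

text \<open>The exceptional null sets are indexed by the countably many pairs \<open>k\<close>,
  \<open>m\<close>.\<close>

lemma AE_sieve_generic:
  assumes cop: "\<And>i j. i \<ge> 1 \<Longrightarrow> j \<ge> 1 \<Longrightarrow> i \<noteq> j \<Longrightarrow> coprime (b i) (b j)"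
    and summ: "summable (\<lambda>j. 1 / real (b j))"
  shows "AE \<omega> in P. sieve_generic b \<omega>"
  unfolding sieve_generic_def
  by (intro AE_ball_countable[THEN iffD2] ballI AE_survivor[OF cop summ]) auto

section \<open>The pushforward measure on admissible sequences\<close>

abbreviation nu_adm :: "(nat \<Rightarrow> nat) measure" where
  "nu_adm \<equiv> restrict_space (nu b P) (X_adm b)"

lemma sets_nu: "sets (nu b P) = sets (borel_sigma X_topology)"
  by (simp add: nu_def)

lemma X_adm_inter_space: "X_adm b \<inter> space (nu b P) \<in> sets (nu b P)"
  by (intro sets.Int sets.top) (simp add: sets_nu)

lemma phi_measurable_nu_adm: "phi b \<in> measurable P nu_adm"
  using phi_measurable phi_in_X_adm
  by (intro measurable_restrict_space2) (auto simp: nu_def)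

text \<open>Every value of \<open>phi b\<close> is admissible, so the restriction discards no mass.
  Statements about \<open>nu_adm\<close> thereby reduce to statements about
  \<open>P\<close>.\<close>

lemma nu_adm_eq_distr: "nu_adm = distr P nu_adm (phi b)"
proof (rule measure_eqI)
  fix A assume A: "A \<in> sets nu_adm"
  then have A': "A \<subseteq> X_adm b" "A \<in> sets (borel_sigma X_topology)"
    using sets_restrict_space_iff[OF X_adm_inter_space] sets_nu by auto
  then have "emeasure nu_adm A = emeasure (nu b P) A"
    by (intro emeasure_restrict_space X_adm_inter_space)
  also have "\<dots> = emeasure P (phi b -` A \<inter> space P)"
    using A' by (simp add: nu_def emeasure_distr)
  also have "\<dots> = emeasure (distr P nu_adm (phi b)) A"
    using A phi_measurable_nu_adm by (simp add: emeasure_distr)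
  finally show "emeasure nu_adm A = emeasure (distr P nu_adm (phi b)) A" .
qed simp

lemma seq_shift_measurable_nu_adm: "seq_shift \<in> measurable nu_adm nu_adm"
  using seq_shift_measurable seq_shift_in_X_adm
  by (intro measurable_restrict_space3)
    (auto simp: nu_def measurable_cong_sets[OF sets_distr sets_distr])

lemma system_P: "measure_preserving_system P (translation b)"
  using P.prob_space_axioms translation_measurable distr_translation
  by (simp add: measure_preserving_system_def)

text \<open>Invariance passes from \<open>P\<close> to its pushforward because \<open>phi b\<close>
  intertwines the translation with the shift.\<close>

lemma system_nu_adm: "measure_preserving_system nu_adm seq_shift"
proof -
  have "prob_space nu_adm"
    using P.prob_space_distr[OF phi_measurable_nu_adm] nu_adm_eq_distr by simp
  moreover have "distr nu_adm nu_adm seq_shift = nu_adm"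
  proof -
    have "distr nu_adm nu_adm seq_shift = distr (distr P nu_adm (phi b)) nu_adm seq_shift"
      by (subst (1) nu_adm_eq_distr) simp
    also have "\<dots> = distr P nu_adm (seq_shift \<circ> phi b)"
      by (rule distr_distr[OF seq_shift_measurable_nu_adm phi_measurable_nu_adm])
    also have "seq_shift \<circ> phi b = phi b \<circ> translation b"
      by (simp add: fun_eq_iff seq_shift_phi)
    also have "distr P nu_adm (phi b \<circ> translation b) = distr (distr P P (translation b)) nu_adm (phi b)"
      by (rule distr_distr[symmetric, OF phi_measurable_nu_adm translation_measurable])
    also have "\<dots> = nu_adm"
      using nu_adm_eq_distr by (simp add: distr_translation)
    finally show ?thesis .
  qed
  ultimately show ?thesis
    using seq_shift_measurable_nu_adm by (simp add: measure_preserving_system_def)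
qed

section \<open>The isomorphism between sets of full measure\<close>

lemma phi_isomorphism:
  assumes generic: "AE \<omega> in P. sieve_generic b \<omega>"
  shows "mds_isomorphism P (translation b) nu_adm seq_shift (phi b)"
proof -
  define M0 where "M0 = {\<omega> \<in> space P. sieve_generic b \<omega>}"
  \<comment> \<open>This is the image of \<open>M0\<close> under \<open>phi b\<close>, described
    through \<open>phi_inv b\<close> so that its measurability follows from that of the two
    maps.\<close>
  define N0 where "N0 = {x \<in> X_adm b. phi_inv b x \<in> M0 \<and> phi b (phi_inv b x) = x}"
  have spP: "space P = topspace (Omega_topology b)" by (simp add: space_P topspace_Omega)
  have M0 [measurable]: "M0 \<in> sets P" unfolding M0_def by measurable
  \<comment> \<open>Equality of sequences becomes countably many coordinate equations; at index
    \<open>0\<close> both sequences are \<open>undefined\<close>.\<close>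
  have fixed: "phi b (phi_inv b x) = x \<longleftrightarrow> (\<forall>n\<in>{1..}. phi b (phi_inv b x) n = x n)"
    if "x \<in> X_adm b" for x
    using PiE_ext[of "phi b (phi_inv b x)" "{1..}" "\<lambda>_. {0, 1}" x] that phi_in_X[of b "phi_inv b x"]
    unfolding X_adm_def topspace_X by auto
  have N0': "N0 \<in> sets (borel_sigma X_topology)"
  proof -
    have [measurable]: "(\<lambda>x. phi b (phi_inv b x) n) \<in> measurable (borel_sigma X_topology) (count_space UNIV)" for n
      using measurable_compose[OF phi_inv_measurable
          measurable_compose[OF phi_measurable measurable_X_component]] .
    have "{x \<in> space (borel_sigma X_topology). x \<in> X_adm b \<and> phi_inv b x \<in> M0 \<and>
        (\<forall>n\<in>{1..}. phi b (phi_inv b x) n = x n)} \<in> sets (borel_sigma X_topology)"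
      by measurable
    also have "{x \<in> space (borel_sigma X_topology). x \<in> X_adm b \<and> phi_inv b x \<in> M0 \<and>
        (\<forall>n\<in>{1..}. phi b (phi_inv b x) n = x n)} = N0"
      using fixed by (auto simp: N0_def X_adm_def)
    finally show ?thesis .
  qed
  then have N0: "N0 \<in> sets nu_adm"
    using sets_restrict_space_iff[OF X_adm_inter_space] by (auto simp: sets_nu N0_def)
  have inv: "phi_inv b (phi b \<omega>) = \<omega>" if "\<omega> \<in> M0" for \<omega>
    using phi_inv_phi that by (auto simp: M0_def spP)
  have phi_N0: "phi b \<omega> \<in> N0" if "\<omega> \<in> M0" for \<omega>
    using inv[OF that] that phi_in_X_adm by (simp add: N0_def)
  have T_M0: "translation b \<omega> \<in> M0" if "\<omega> \<in> M0" for \<omega>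
    using that sieve_generic_translation translation_in_Omega by (auto simp: M0_def spP)
  have S_N0: "seq_shift x \<in> N0" if "x \<in> N0" for x
  proof -
    have "x = phi b (phi_inv b x)" "phi_inv b x \<in> M0" using that by (auto simp: N0_def)
    then show ?thesis by (metis seq_shift_phi T_M0 phi_N0)
  qed
  have bij: "bij_betw (phi b) M0 N0"
    by (rule bij_betwI[where g = "phi_inv b"]) (use inv phi_N0 in \<open>auto simp: N0_def\<close>)
  have M0_full: "emeasure P (space P - M0) = 0"
    using generic by (subst (asm) AE_iff_measurable[of "space P - M0"]) (auto simp: M0_def)
  have N0_full: "emeasure nu_adm (space nu_adm - N0) = 0"
  proof -
    have "emeasure nu_adm (space nu_adm - N0) = emeasure (distr P nu_adm (phi b)) (space nu_adm - N0)"
      by (subst (1) nu_adm_eq_distr) simp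
    also have "\<dots> = emeasure P (phi b -` (space nu_adm - N0) \<inter> space P)"
      using N0 phi_measurable_nu_adm by (intro emeasure_distr) auto
    \<comment> \<open>Points of \<open>M0\<close> are sent into \<open>N0\<close>, so the preimage
      of the complement of \<open>N0\<close> avoids \<open>M0\<close>.\<close>
    also have "\<dots> \<le> emeasure P (space P - M0)"
      using phi_N0 by (intro emeasure_mono) auto
    finally show ?thesis using M0_full by simp
  qed
  have phi_meas: "phi b \<in> measurable (restrict_space P M0) (restrict_space nu_adm N0)"
    using phi_measurable_nu_adm phi_N0 by (intro measurable_restrict_space3) auto
  have "phi_inv b \<in> measurable nu_adm P"
    by (rule measurable_restrict_space1)
      (use phi_inv_measurable in \<open>simp add: measurable_cong_sets[OF sets_nu refl]\<close>)
  then have "phi_inv b \<in> measurable (restrict_space nu_adm N0) (restrict_space P M0)"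
    by (rule measurable_restrict_space3) (auto simp: N0_def)
  moreover have "the_inv_into M0 (phi b) x = phi_inv b x" if "x \<in> N0" for x
    by (rule the_inv_into_f_eq) (use that bij in \<open>auto simp: N0_def bij_betw_def\<close>)
  ultimately have inv_meas:
      "the_inv_into M0 (phi b) \<in> measurable (restrict_space nu_adm N0) (restrict_space P M0)"
    by (subst measurable_cong[where g = "phi_inv b"]) (auto simp: space_restrict_space)
  have distr_eq: "distr (restrict_space P M0) (restrict_space nu_adm N0) (phi b) = restrict_space nu_adm N0"
  proof (rule measure_eqI)
    fix A assume "A \<in> sets (distr (restrict_space P M0) (restrict_space nu_adm N0) (phi b))"
    then have A: "A \<in> sets (restrict_space nu_adm N0)" by simp
    then have A': "A \<subseteq> N0" "A \<in> sets nu_adm"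
      using sets_restrict_space_iff[of N0 nu_adm] N0 by auto
    let ?B = "phi b -` A \<inter> space P"
    have B: "?B \<in> sets P" using measurable_sets[OF phi_measurable_nu_adm A'(2)] .
    have "emeasure (distr (restrict_space P M0) (restrict_space nu_adm N0) (phi b)) A
        = emeasure (restrict_space P M0) (phi b -` A \<inter> space (restrict_space P M0))"
      using A phi_meas by (simp add: emeasure_distr)
    also have "\<dots> = emeasure (restrict_space P M0) (?B \<inter> M0)"
      by (rule arg_cong[where f = "emeasure _"]) (auto simp: space_restrict_space M0_def)
    also have "\<dots> = emeasure P (?B \<inter> M0)"
      by (intro emeasure_restrict_space) auto
    \<comment> \<open>Almost every point lies in \<open>M0\<close>, so intersecting with it
      preserves the measure.\<close>
    also have "\<dots> = emeasure P ?B"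
    proof (rule emeasure_eq_AE)
      show "AE \<omega> in P. \<omega> \<in> ?B \<inter> M0 \<longleftrightarrow> \<omega> \<in> ?B"
        using generic by eventually_elim (auto simp: M0_def)
    qed (use B in auto)
    also have "\<dots> = emeasure (distr P nu_adm (phi b)) A"
      using A' phi_measurable_nu_adm by (simp add: emeasure_distr)
    also have "\<dots> = emeasure nu_adm A" by (simp flip: nu_adm_eq_distr)
    also have "\<dots> = emeasure (restrict_space nu_adm N0) A"
      using A' N0 by (intro emeasure_restrict_space[symmetric]) auto
    finally show "emeasure (distr (restrict_space P M0) (restrict_space nu_adm N0) (phi b)) A
        = emeasure (restrict_space nu_adm N0) A" .
  qed simp
  show ?thesis
    unfolding mds_isomorphism_def
    using system_P system_nu_adm M0 N0 M0_full N0_full T_M0 S_N0 bij phi_meas inv_meas distr_eq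
    by (intro conjI bexI[of _ M0] bexI[of _ N0]) (auto simp: seq_shift_phi)
qed

end

end

theorem theorem3p1:
  fixes b :: "nat \<Rightarrow> nat" and P :: "(nat \<Rightarrow> int) measure"
  assumes "\<And>k. k \<ge> 1 \<Longrightarrow> b k \<ge> 2"
    and "\<And>j k. j \<ge> 1 \<Longrightarrow> k \<ge> 1 \<Longrightarrow> j \<noteq> k \<Longrightarrow> coprime (b j) (b k)"
    and "(\<lambda>k. 1 / real (b k)) summable_on {1..}"
    and "normalized_haar (Omega b) (Omega_topology b) P"
  shows "mds_isomorphism P (translation b) (restrict_space (nu b P) (X_adm b)) seq_shift (phi b)"
proof -
  \<comment> \<open>The value \<open>b 0\<close> is unconstrained, but it contributes a single term,
    so summability extends from the positive indices to a series over all of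
    \<open>nat\<close>.\<close>
  have "insert 0 {1..} = (UNIV :: nat set)" by auto
  moreover have "(\<lambda>k. 1 / real (b k)) summable_on insert 0 {1..}"
    using assms(3) by (simp only: summable_on_insert_iff)
  ultimately have "(\<lambda>k. 1 / real (b k)) summable_on UNIV" by simp
  then have "summable (\<lambda>k. 1 / real (b k))"
    by (rule summable_on_imp_summable)
  then have "AE \<omega> in P. sieve_generic b \<omega>"
    using assms by (intro AE_sieve_generic) auto
  then show ?thesis
    using assms by (intro phi_isomorphism) auto
qed

end
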